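(* Let $(n,2d)=(3,6)$ and $m=9$ (resp. $(n,2d)=(4,4)$ and $m=8$). Suppose that the set of real projective points $\Gamma=\{\gamma_1,\ldots,\gamma_m\}$ comes from the (completely real) transverse intersection of two ternary cubics in $H_{3,3}$ (resp. three quaternary quadrics in $H_{4,2}$). Let $v_1,\ldots,v_m\in\mathbb{R}^n$ be affine representatives of the points of $\Gamma$, let $E:H_{n,2d}\to\mathbb{R}^m$ be the evaluation map $E(p)=(p(v_1),\ldots,p(v_m))$, and let $P'=E(P_{n,2d})$. Then $\mathbb{R}^9_{++}\subset P'$ (resp. $\mathbb{R}^8_{++}\subset P'$).
   Context: $H_{n,d}$ is the real vector space of real forms (homogeneous polynomials) of degree $d$ in $n$ variables. $P_{n,2d}=\{p\in H_{n,2d} : p(x)\ge 0 \text{ for all } x\in\mathbb{R}^n\}$. $\mathbb{R}^m_{++}$ is the open strictly positive orthant of $\mathbb{R}^m$. Forms $f_1,\ldots,f_{n-1}\in H_{n,d}$ intersect transversely if their common zero set in $\mathbb{CP}^{n-1}$ is finite and at each common zero their gradients are linearly independent; it then consists of exactly $d^{n-1}$ distinct points. An affine representative of a projective point is a nonzero vector spanning the corresponding line. *)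

theory Defs
  imports "HOL-Analysis.Analysis" "HOL-Library.Poly_Mapping"
begin

text \<open>
  A real polynomial in variables indexed by the finite type \<open>'n\<close> is a finitely supported family of
  coefficients indexed by exponents. Keeping coefficients (rather than functions on real space)
  lets the same form be evaluated at real and at complex vectors.
\<close>

type_synonym 'n rpoly = "('n \<Rightarrow>\<^sub>0 nat) \<Rightarrow>\<^sub>0 real"

definition forms :: "nat \<Rightarrow> ('n::finite) rpoly set" where
  "forms d = {p. \<forall>\<alpha>\<in>Poly_Mapping.keys p. (\<Sum>i\<in>UNIV. Poly_Mapping.lookup \<alpha> i) = d}"

definition poly_eval :: "('n::finite) rpoly \<Rightarrow> 'a::real_normed_field ^ 'n \<Rightarrow> 'a" where
  "poly_eval p x =
     (\<Sum>\<alpha>\<in>Poly_Mapping.keys p.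
        of_real (Poly_Mapping.lookup p \<alpha>) * (\<Prod>i\<in>UNIV. (x $ i) ^ Poly_Mapping.lookup \<alpha> i))"

definition nonneg_forms :: "nat \<Rightarrow> ('n::finite) rpoly set" where
  "nonneg_forms d = {p \<in> forms d. \<forall>x :: real ^ 'n. 0 \<le> poly_eval p x}"

definition gradient :: "('n::finite) rpoly \<Rightarrow> 'a::real_normed_field ^ 'n \<Rightarrow> 'a ^ 'n" where
  "gradient p x = (\<chi> i. deriv (\<lambda>t. poly_eval p (x + t *s axis i 1)) 0)"

text \<open>
  A projective point is a one-dimensional linear subspace; an affine representative is a nonzero
  vector spanning it. Note that \<^const>\<open>vec.span\<close> is the span over the coordinate field, whereas
  \<^const>\<open>span\<close> would be the real span also for complex vectors.
\<close>

definition affine_rep :: "'a::field ^ 'n::finite \<Rightarrow> ('a ^ 'n) set \<Rightarrow> bool" where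
  "affine_rep x L \<longleftrightarrow> x \<noteq> 0 \<and> L = vec.span {x}"

definition common_zeros :: "('n::finite) rpoly list \<Rightarrow> ('a::real_normed_field ^ 'n) set set" where
  "common_zeros fs = {L. \<exists>x. affine_rep x L \<and> (\<forall>f\<in>set fs. poly_eval f x = 0)}"

definition intersect_transversely :: "nat \<Rightarrow> ('n::finite) rpoly list \<Rightarrow> bool" where
  "intersect_transversely d fs \<longleftrightarrow>
     length fs = CARD('n) - 1 \<and> set fs \<subseteq> forms d \<and>
     finite (common_zeros fs :: (complex ^ 'n) set set) \<and>
     (\<forall>z :: complex ^ 'n. z \<noteq> 0 \<and> (\<forall>f\<in>set fs. poly_eval f z = 0) \<longrightarrow>
        distinct (map (\<lambda>f. gradient f z) fs) \<and>
        vec.independent (set (map (\<lambda>f. gradient f z) fs)))"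

definition completely_real :: "('n::finite) rpoly list \<Rightarrow> bool" where
  "completely_real fs \<longleftrightarrow>
     (\<forall>L \<in> (common_zeros fs :: (complex ^ 'n) set set).
        \<exists>x :: real ^ 'n. affine_rep (\<chi> i. complex_of_real (x $ i)) L)"

definition eval_map :: "real ^ 'n ^ 'm \<Rightarrow> ('n::finite) rpoly \<Rightarrow> real ^ ('m::finite)" where
  "eval_map v p = (\<chi> j. poly_eval p (v $ j))"

definition pos_orthant :: "(real ^ 'm::finite) set" where
  "pos_orthant = {y. \<forall>j. 0 < y $ j}"

end

theory Submission
  imports Defs
begin

text \<open>
  If a form \<open>p\<close> of degree \<open>2d\<close> is positive at the finitely many common zeros of the \<open>f\<^sub>i\<close>, then
  \<open>p + K \<Sum>f\<^sub>i\<^sup>2\<close> is nonnegative for large \<open>K\<close>, by compactness of the sphere, and has the same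
  values at these zeros. So it suffices to interpolate arbitrary values, that is, to find for each
  point a form of degree \<open>2d\<close> vanishing at all other points but not at it. Products of linear forms
  do this: \<open>d + 1\<close> common zeros on a line would force the whole line into the zero set, so the other
  points can be grouped into at most \<open>2d\<close> singletons and pairs not collinear with the given point.
\<close>

section \<open>Evaluation as a ring homomorphism and the grading of forms\<close>

text \<open>Reduces multiplicativity of evaluation to products of two monomials.\<close>

lemma sum_single_keys:
  "(\<Sum>\<alpha>\<in>Poly_Mapping.keys p. Poly_Mapping.single \<alpha> (Poly_Mapping.lookup p \<alpha>)) = p"
proof (rule poly_mapping_eqI)
  fix k
  have "(\<Sum>\<alpha>\<in>Poly_Mapping.keys p. Poly_Mapping.lookup (Poly_Mapping.single \<alpha> (Poly_Mapping.lookup p \<alpha>)) k)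
      = (\<Sum>\<alpha>\<in>Poly_Mapping.keys p. if \<alpha> = k then Poly_Mapping.lookup p k else 0)"
    by (intro sum.cong) (auto simp: lookup_single)
  then show "Poly_Mapping.lookup
      (\<Sum>\<alpha>\<in>Poly_Mapping.keys p. Poly_Mapping.single \<alpha> (Poly_Mapping.lookup p \<alpha>)) k
      = Poly_Mapping.lookup p k"
    by (auto simp: lookup_sum in_keys_iff)
qed

text \<open>Lets polynomials with different supports be evaluated over one common index set.\<close>

lemma poly_eval_superset:
  assumes "finite S" "Poly_Mapping.keys p \<subseteq> S"
  shows "poly_eval p x =
    (\<Sum>\<alpha>\<in>S. of_real (Poly_Mapping.lookup p \<alpha>) * (\<Prod>i\<in>UNIV. (x $ i) ^ Poly_Mapping.lookup \<alpha> i))"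
  unfolding poly_eval_def
  by (rule sum.mono_neutral_left) (use assms in \<open>auto simp: in_keys_iff\<close>)

lemma poly_eval_0 [simp]: "poly_eval 0 x = 0"
  by (simp add: poly_eval_def)

lemma poly_eval_single:
  "poly_eval (Poly_Mapping.single \<alpha> c) x = of_real c * (\<Prod>i\<in>UNIV. (x $ i) ^ Poly_Mapping.lookup \<alpha> i)"
  by (subst poly_eval_superset [of "{\<alpha>}"]) auto

lemma poly_eval_1 [simp]: "poly_eval 1 x = 1"
  by (simp flip: single_one add: poly_eval_single)

lemma poly_eval_add: "poly_eval (p + q) x = poly_eval p x + poly_eval q x"
proof -
  let ?S = "Poly_Mapping.keys p \<union> Poly_Mapping.keys q"
  show ?thesis
    using keys_add[of p q]
    by (simp add: poly_eval_superset[of ?S] lookup_add distrib_right sum.distrib)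
qed

lemma poly_eval_sum: "poly_eval (\<Sum>i\<in>I. p i) x = (\<Sum>i\<in>I. poly_eval (p i) x)"
  by (induction I rule: infinite_finite_induct) (auto simp: poly_eval_add)

lemma poly_eval_mult: "poly_eval (p * q) x = poly_eval p x * poly_eval q x"
proof -
  let ?m = "\<lambda>p \<alpha>. Poly_Mapping.single \<alpha> (Poly_Mapping.lookup p \<alpha>)"
  have "p * q = (\<Sum>\<alpha>\<in>Poly_Mapping.keys p. \<Sum>\<beta>\<in>Poly_Mapping.keys q. ?m p \<alpha> * ?m q \<beta>)"
    by (simp only: sum_single_keys flip: sum_product)
  then have "poly_eval (p * q) x =
      (\<Sum>\<alpha>\<in>Poly_Mapping.keys p. \<Sum>\<beta>\<in>Poly_Mapping.keys q. poly_eval (?m p \<alpha>) x * poly_eval (?m q \<beta>) x)"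
    by (simp add: poly_eval_sum mult_single poly_eval_single lookup_add power_add prod.distrib mult_ac)
  also have "\<dots> = poly_eval p x * poly_eval q x"
    by (simp only: sum_single_keys flip: sum_product poly_eval_sum)
  finally show ?thesis .
qed

lemma poly_eval_prod_list: "poly_eval (prod_list ps) x = prod_list (map (\<lambda>p. poly_eval p x) ps)"
  by (induction ps) (auto simp: poly_eval_mult)

lemma forms_0 [simp]: "0 \<in> forms d"
  by (simp add: forms_def)

lemma forms_1: "1 \<in> forms 0"
  by (simp add: forms_def)

lemma forms_add: "p \<in> forms d \<Longrightarrow> q \<in> forms d \<Longrightarrow> p + q \<in> forms d"
  using keys_add[of p q] by (auto simp: forms_def)

lemma forms_sum: "(\<And>i. i \<in> I \<Longrightarrow> p i \<in> forms d) \<Longrightarrow> (\<Sum>i\<in>I. p i) \<in> forms d"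
  by (induction I rule: infinite_finite_induct) (auto intro: forms_add)

lemma forms_mult: "p \<in> forms d \<Longrightarrow> q \<in> forms e \<Longrightarrow> p * q \<in> forms (d + e)"
  using keys_mult[of p q] by (fastforce simp: forms_def lookup_add sum.distrib)

lemma forms_const: "Poly_Mapping.single 0 c \<in> forms 0"
  by (simp add: forms_def)

lemma forms_prod_list: "set ps \<subseteq> forms 1 \<Longrightarrow> prod_list ps \<in> forms (length ps)"
  by (induction ps) (auto simp: forms_1 intro: forms_mult[where d = "Suc 0", simplified])

text \<open>Supplies equations of hyperplanes with prescribed normal vector.\<close>

lemma linear_form_exists:
  fixes z :: "real ^ 'n"
  obtains l where "l \<in> forms 1" "\<And>x :: real ^ 'n. poly_eval l x = z \<bullet> x"
proof
  let ?l = "\<Sum>i\<in>UNIV. Poly_Mapping.single (Poly_Mapping.single i (1::nat)) (z $ i)"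
  show "?l \<in> forms 1"
    by (intro forms_sum) (auto simp: forms_def lookup_single when_def)
  have "(\<Prod>j\<in>UNIV. (x $ j) ^ (Poly_Mapping.lookup (Poly_Mapping.single i (1::nat)) j)) = x $ i"
    for x :: "real ^ 'n" and i
    by (subst prod.mono_neutral_right[of _ "{i}"]) (auto simp: lookup_single when_def)
  then show "poly_eval ?l x = z \<bullet> x" for x :: "real ^ 'n"
    by (simp add: poly_eval_sum poly_eval_single inner_vec_def)
qed

section \<open>Homogeneity and restriction to lines\<close>

lemma poly_eval_scale:
  fixes x :: "real ^ 'n"
  assumes "p \<in> forms d"
  shows "poly_eval p (c *\<^sub>R x) = c ^ d * poly_eval p x"
proof -
  have "(\<Prod>i\<in>UNIV. (c * x $ i) ^ Poly_Mapping.lookup \<alpha> i)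
      = c ^ d * (\<Prod>i\<in>UNIV. (x $ i) ^ Poly_Mapping.lookup \<alpha> i)"
    if "\<alpha> \<in> Poly_Mapping.keys p" for \<alpha>
    using assms that by (simp add: forms_def power_mult_distrib prod.distrib flip: power_sum)
  then show ?thesis
    by (simp add: poly_eval_def sum_distrib_left mult_ac)
qed

lemma continuous_on_poly_eval: "continuous_on S (poly_eval p :: real ^ 'n \<Rightarrow> real)"
  unfolding poly_eval_def by (intro continuous_intros)

text \<open>Each monomial becomes a product of \<open>d\<close> factors
  \<open>[:a $ i, x $ i:]\<close>, counted with multiplicity. The degree can drop below
  \<open>d\<close>, for instance when some \<open>x $ i\<close> is zero.\<close>

lemma poly_eval_on_line:
  fixes a x :: "real ^ 'n"
  assumes "p \<in> forms d"
  obtains P where "degree P \<le> d" "\<And>s. poly P s = poly_eval p (a + s *\<^sub>R x)"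
proof
  let ?P = "\<Sum>\<alpha>\<in>Poly_Mapping.keys p. smult (Poly_Mapping.lookup p \<alpha>)
      (\<Prod>i\<in>UNIV. [:a $ i, x $ i:] ^ Poly_Mapping.lookup \<alpha> i)"
  show "poly ?P s = poly_eval p (a + s *\<^sub>R x)" for s
    by (simp add: poly_eval_def poly_sum poly_prod)
  show "degree ?P \<le> d"
  proof (intro degree_sum_le)
    fix \<alpha> assume \<alpha>: "\<alpha> \<in> Poly_Mapping.keys p"
    have "degree (smult (Poly_Mapping.lookup p \<alpha>)
        (\<Prod>i\<in>UNIV. [:a $ i, x $ i:] ^ Poly_Mapping.lookup \<alpha> i))
        \<le> degree (\<Prod>i\<in>UNIV. [:a $ i, x $ i:] ^ Poly_Mapping.lookup \<alpha> i)"
      by (rule degree_smult_le)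
    also have "\<dots> \<le> (\<Sum>i\<in>UNIV. degree ([:a $ i, x $ i:] ^ Poly_Mapping.lookup \<alpha> i))"
      using degree_prod_sum_le[of UNIV "\<lambda>i. [:a $ i, x $ i:] ^ Poly_Mapping.lookup \<alpha> i"]
      by (simp add: o_def)
    also have "\<dots> \<le> (\<Sum>i\<in>UNIV. Poly_Mapping.lookup \<alpha> i)"
    proof (intro sum_mono)
      fix i
      have "degree ([:a $ i, x $ i:] ^ Poly_Mapping.lookup \<alpha> i)
          \<le> degree [:a $ i, x $ i:] * Poly_Mapping.lookup \<alpha> i"
        by (rule degree_power_le)
      also have "\<dots> \<le> Poly_Mapping.lookup \<alpha> i"
        by simp
      finally show "degree ([:a $ i, x $ i:] ^ Poly_Mapping.lookup \<alpha> i) \<le> Poly_Mapping.lookup \<alpha> i" .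
    qed
    also have "\<dots> = d"
      using assms \<alpha> by (simp add: forms_def)
    finally show "degree (smult (Poly_Mapping.lookup p \<alpha>)
        (\<Prod>i\<in>UNIV. [:a $ i, x $ i:] ^ Poly_Mapping.lookup \<alpha> i)) \<le> d" .
  qed auto
qed

text \<open>Restricted to combinations of \<open>a\<close> and \<open>x\<close>, \<open>p\<close> is
  a binary form of degree \<open>d\<close>. It has at least \<open>d + 1\<close> zeros: the
  parameters in \<open>S\<close> and \<open>x\<close> itself, the point at infinity.\<close>

lemma vanishes_on_line:
  fixes a x :: "real ^ 'n"
  assumes p: "p \<in> forms d" and x: "poly_eval p x = 0"
    and S: "finite S" "d \<le> card S" "\<And>s. s \<in> S \<Longrightarrow> poly_eval p (a + s *\<^sub>R x) = 0"
  shows "poly_eval p (a + s *\<^sub>R x) = 0"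
proof -
  obtain P where P: "degree P \<le> d" "\<And>s. poly P s = poly_eval p (a + s *\<^sub>R x)"
    using poly_eval_on_line [OF p, of a x] by blast
  obtain Q where Q: "\<And>s. poly Q s = poly_eval p (x + s *\<^sub>R a)"
    using poly_eval_on_line [OF p, of x a] by blast
  txt \<open>\<open>P\<close> has \<open>d\<close> roots in \<open>S\<close>; the zero \<open>x\<close> at infinity kills its coefficient of degree \<open>d\<close>.\<close>
  have "P = 0"
  proof (rule ccontr)
    assume "P \<noteq> 0"
    have "card S \<le> card {s. poly P s = 0}"
      using S P by (intro card_mono poly_roots_finite \<open>P \<noteq> 0\<close>) auto
    also have "\<dots> \<le> degree P"
      by (rule card_poly_roots_bound [OF \<open>P \<noteq> 0\<close>])
    \<comment> \<open>The degree must be exactly \<open>d\<close>, because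
      \<open>reflect_poly\<close> reverses coefficients relative to the actual degree.\<close>
    finally have deg: "degree P = d"
      using S(2) P(1) by simp
    \<comment> \<open>Reversal passes to the chart centred at \<open>x\<close>: both sides are
      \<open>s ^ d\<close> times the value of \<open>P\<close> at \<open>inverse s\<close>.\<close>
    have eq: "poly (reflect_poly P) s = poly Q s" if "s \<noteq> 0" for s
    proof -
      have "s *\<^sub>R (a + inverse s *\<^sub>R x) = x + s *\<^sub>R a"
        using that by (simp add: scaleR_add_right)
      then show ?thesis
        using that poly_eval_scale[OF p, of s "a + inverse s *\<^sub>R x"]
        by (simp add: poly_reflect_poly_nz deg P Q)
    qed
    have "infinite {s::real. poly (reflect_poly P - Q) s = 0}"
    proof (rule infinite_super)
      show "{0<..} \<subseteq> {s::real. poly (reflect_poly P - Q) s = 0}"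
        using eq by auto
      show "infinite {0::real<..}"
        by (rule infinite_Ioi)
    qed
    then have "reflect_poly P = Q"
      using poly_roots_finite[of "reflect_poly P - Q"] by auto
    \<comment> \<open>At \<open>0\<close> the reversed polynomial takes the leading coefficient of
      \<open>P\<close> as its value, while \<open>Q\<close> takes the value of \<open>p\<close> at
      \<open>x\<close>.\<close>
    then have "poly (reflect_poly P) 0 = 0"
      using Q[of 0] x by simp
    then show False
      using \<open>P \<noteq> 0\<close> by (simp add: poly_0_coeff_0)
  qed
  then show ?thesis
    using P(2)[of s] by simp
qed

section \<open>Nonnegativity by compactness of the sphere\<close>

lemma nonneg_form_exists:
  fixes p :: "('n::finite) rpoly"
  assumes p: "p \<in> forms (2 * d)" and fs: "set fs \<subseteq> forms d"
    and pos: "\<And>x :: real ^ 'n. x \<noteq> 0 \<Longrightarrow> \<forall>f\<in>set fs. poly_eval f x = 0 \<Longrightarrow> 0 < poly_eval p x"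
  obtains q where "q \<in> nonneg_forms (2 * d)"
    "\<And>x :: real ^ 'n. \<forall>f\<in>set fs. poly_eval f x = 0 \<Longrightarrow> poly_eval q x = poly_eval p x"
proof -
  define g where "g = (\<Sum>f\<in>set fs. f * f)"
  have g: "g \<in> forms (2 * d)"
    unfolding g_def mult_2 using fs by (intro forms_sum forms_mult) auto
  have evg: "poly_eval g x = (\<Sum>f\<in>set fs. (poly_eval f x)\<^sup>2)" for x :: "real ^ 'n"
    by (simp add: g_def poly_eval_sum poly_eval_mult power2_eq_square)
  have g_nonneg: "0 \<le> poly_eval g x" for x :: "real ^ 'n"
    by (simp add: evg sum_nonneg)
  have g_0: "poly_eval g x = 0 \<longleftrightarrow> (\<forall>f\<in>set fs. poly_eval f x = 0)" for x :: "real ^ 'n"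
    by (simp add: evg sum_nonneg_eq_0_iff)
  \<comment> \<open>Only on \<open>A\<close> does \<open>p\<close> need a correction. No common zero
    lies there by \<open>pos\<close>, so \<open>g\<close> is positive on \<open>A\<close> and the
    ratio of \<open>- p\<close> to \<open>g\<close> is bounded.\<close>
  define A where "A = sphere 0 1 \<inter> {x :: real ^ 'n. poly_eval p x \<le> 0}"
  have "closed {x :: real ^ 'n. poly_eval p x \<le> 0}"
    by (intro closed_Collect_le continuous_on_poly_eval continuous_on_const)
  then have A: "compact A"
    unfolding A_def by (intro compact_Int_closed compact_sphere)
  have gA: "0 < poly_eval g x" if "x \<in> A" for x
  proof -
    have "x \<noteq> 0" "\<not> 0 < poly_eval p x"
      using that by (auto simp: A_def)
    then have "poly_eval g x \<noteq> 0"
      using pos g_0 by blast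
    then show ?thesis
      using g_nonneg[of x] by simp
  qed
  obtain K where K: "0 \<le> K" "\<And>x. x \<in> A \<Longrightarrow> - poly_eval p x / poly_eval g x \<le> K"
  proof -
    have "continuous_on A (\<lambda>x. - poly_eval p x / poly_eval g x)"
      using gA by (intro continuous_intros continuous_on_poly_eval) force
    then have "bounded ((\<lambda>x. - poly_eval p x / poly_eval g x) ` A)"
      by (intro compact_imp_bounded compact_continuous_image A)
    then obtain B where "\<And>x. x \<in> A \<Longrightarrow> \<bar>- poly_eval p x / poly_eval g x\<bar> \<le> B"
      unfolding bounded_iff by auto
    \<comment> \<open>The maximum with \<open>0\<close> keeps \<open>K\<close> nonnegative, so that
      adding \<open>K\<close> times \<open>g\<close> does no harm outside \<open>A\<close>.\<close>
    then have "\<And>x. x \<in> A \<Longrightarrow> - poly_eval p x / poly_eval g x \<le> max 0 B"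
      by (metis abs_le_D1 max.coboundedI2)
    then show thesis
      using that[of "max 0 B"] by simp
  qed
  define q where "q = p + Poly_Mapping.single 0 K * g"
  have evq: "poly_eval q x = poly_eval p x + K * poly_eval g x" for x :: "real ^ 'n"
    by (simp add: q_def poly_eval_add poly_eval_mult poly_eval_single)
  have q: "q \<in> forms (2 * d)"
    unfolding q_def using forms_mult[OF forms_const g] by (auto intro: forms_add p)
  have sphere: "0 \<le> poly_eval q x" if "norm x = 1" for x :: "real ^ 'n"
  proof (cases "x \<in> A")
    case True
    then show ?thesis
      using K(2)[OF True] gA[OF True] by (simp add: evq field_simps)
  next
    case False
    then show ?thesis
      using that K(1) g_nonneg[of x] by (simp add: evq A_def)
  qed
  have "0 \<le> poly_eval q x" for x :: "real ^ 'n"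
  proof -
    have "0 \<le> norm x ^ (2 * d) * poly_eval q (sgn x)" if "x \<noteq> 0"
      using that by (intro mult_nonneg_nonneg sphere) (auto simp: norm_sgn)
    moreover have "norm x *\<^sub>R sgn x = x"
      by (cases "x = 0") (simp_all add: sgn_div_norm)
    ultimately have nz: "0 \<le> poly_eval q x" if "x \<noteq> 0"
      using that poly_eval_scale[OF q, of "norm x" "sgn x"] by simp
    show ?thesis
    proof (cases "x = 0")
      case True
      \<comment> \<open>The origin is written as \<open>0\<close> times a unit vector, so that
        scaling also covers \<open>d = 0\<close>, where a form is a constant.\<close>
      have *: "norm (axis undefined 1 :: real ^ 'n) = 1"
        by simp
      have "poly_eval q (0 *\<^sub>R (axis undefined 1 :: real ^ 'n)) \<ge> 0"
        unfolding poly_eval_scale[OF q] using sphere[OF *] by simp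
      then show ?thesis using True by simp
    qed (use nz in auto)
  qed
  then have "q \<in> nonneg_forms (2 * d)"
    using q by (simp add: nonneg_forms_def)
  moreover have "poly_eval q x = poly_eval p x" if "\<forall>f\<in>set fs. poly_eval f x = 0" for x :: "real ^ 'n"
    using that g_0 by (simp add: evq)
  ultimately show thesis by (rule that)
qed


section \<open>Separating one point by a product of linear forms\<close>

text \<open>Each block \<open>B\<close> contributes one hyperplane that contains its points and
  misses \<open>v j\<close>. The product of their equations has one degree per block, whence the
  length of the list.\<close>

lemma separating_form_exists:
  fixes v :: "'m \<Rightarrow> real ^ 'n"
  assumes "\<And>B. B \<in> set Bs \<Longrightarrow> v j \<notin> span (v ` B)" "- {j} \<subseteq> \<Union>(set Bs)"
  obtains q where "q \<in> forms (length Bs)" "poly_eval q (v j) \<noteq> 0"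
    "\<And>i. i \<noteq> j \<Longrightarrow> poly_eval q (v i) = 0"
proof -
  have "\<exists>l\<in>forms 1. poly_eval l (v j) \<noteq> 0 \<and> (\<forall>i\<in>B. poly_eval l (v i) = 0)"
    if B: "B \<in> set Bs" for B
  proof -
    \<comment> \<open>The normal vector is the component \<open>z\<close> of \<open>v j\<close>
      orthogonal to the span. It is nonzero, and its inner product with \<open>v j\<close> is
      \<open>z \<bullet> z\<close>.\<close>
    obtain y z where y: "y \<in> span (v ` B)" and z: "\<And>w. w \<in> span (v ` B) \<Longrightarrow> orthogonal z w"
      and yz: "v j = y + z"
      using orthogonal_subspace_decomp_exists[of "v ` B" "v j"] by blast
    obtain l where l: "l \<in> forms 1" "\<And>x :: real ^ 'n. poly_eval l x = z \<bullet> x"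
      using linear_form_exists[of z] by blast
    have "z \<noteq> 0"
      using y yz assms(1)[OF B] by auto
    then have "poly_eval l (v j) \<noteq> 0"
      using z[OF y] by (simp add: l yz inner_add_right orthogonal_def)
    moreover have "poly_eval l (v i) = 0" if "i \<in> B" for i
      using z[of "v i"] that by (simp add: l orthogonal_def span_base)
    ultimately show ?thesis
      using l(1) by blast
  qed
  then obtain l where l: "\<And>B. B \<in> set Bs \<Longrightarrow> l B \<in> forms 1"
    "\<And>B. B \<in> set Bs \<Longrightarrow> poly_eval (l B) (v j) \<noteq> 0"
    "\<And>B i. B \<in> set Bs \<Longrightarrow> i \<in> B \<Longrightarrow> poly_eval (l B) (v i) = 0"
    by metis
  show thesis
  proof
    show "prod_list (map l Bs) \<in> forms (length Bs)"
      using forms_prod_list[of "map l Bs"] l(1) by auto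
    show "poly_eval (prod_list (map l Bs)) (v j) \<noteq> 0"
      using l(2) by (auto simp: poly_eval_prod_list prod_list_zero_iff)
    show "poly_eval (prod_list (map l Bs)) (v i) = 0" if i: "i \<noteq> j" for i
    proof -
      obtain B where "B \<in> set Bs" "i \<in> B"
        using assms(2) i by blast
      then show ?thesis
        using l(3)[of B i] by (force simp: poly_eval_prod_list prod_list_zero_iff)
    qed
  qed
qed

section \<open>Geometry of the real common zeros\<close>

text \<open>The setting shared by cubics and quadrics. Injectivity of \<open>\<gamma>\<close>
  separates the representatives, surjectivity ensures that no real common zero is missed, and the
  finite index type makes the zero set finite.\<close>

locale finite_zero_set =
  fixes fs :: "('n::finite) rpoly list" and d :: nat
    and \<gamma> :: "'m::finite \<Rightarrow> (real ^ 'n) set" and v :: "real ^ 'n ^ 'm"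
  assumes fs: "set fs \<subseteq> forms d"
    and bij: "bij_betw \<gamma> UNIV (common_zeros fs)"
    and rep: "\<And>j. affine_rep (v $ j) (\<gamma> j)"
begin

text \<open>Membership in \<open>common_zeros\<close> concerns some spanning vector of the line;
  homogeneity carries the zero over to the chosen one.\<close>

lemma zero: "f \<in> set fs \<Longrightarrow> poly_eval f (v $ j) = 0"
proof -
  assume f: "f \<in> set fs"
  have "\<gamma> j \<in> common_zeros fs"
    using bij by (auto simp: bij_betw_def)
  then obtain x where x: "\<gamma> j = span {x}" "poly_eval f x = 0"
    using f by (auto simp: common_zeros_def affine_rep_def span_vec_eq)
  have "v $ j \<in> \<gamma> j"
    using rep[of j] by (auto simp: affine_rep_def span_vec_eq intro: span_base)
  then obtain c where "v $ j = c *\<^sub>R x"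
    using x by (auto simp: span_singleton)
  then show ?thesis
    using f fs x by (auto simp: poly_eval_scale[of _ d])
qed

text \<open>Reduces positivity at all real common zeros to positivity at the
  representatives.\<close>

lemma zero_is_multiple:
  assumes "x \<noteq> 0" "\<forall>f\<in>set fs. poly_eval f x = 0"
  obtains j c where "x = c *\<^sub>R v $ j" "c \<noteq> 0"
proof -
  have "span {x} \<in> common_zeros fs"
    using assms by (auto simp: common_zeros_def affine_rep_def span_vec_eq)
  then obtain j where "span {x} = \<gamma> j"
    using bij by (auto simp: bij_betw_def)
  then have "x \<in> span {v $ j}"
    using rep[of j] by (metis affine_rep_def span_vec_eq insertI1 span_base)
  with that show thesis
    using \<open>x \<noteq> 0\<close> by (force simp: span_singleton)
qed

lemma rep_nonzero: "v $ j \<noteq> 0"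
  using rep by (simp add: affine_rep_def)

lemma rep_not_in_span:
  assumes "i \<noteq> j"
  shows "v $ i \<notin> span {v $ j}"
proof
  assume *: "v $ i \<in> span {v $ j}"
  then obtain c where c: "v $ i = c *\<^sub>R v $ j"
    by (auto simp: span_singleton)
  then have "c \<noteq> 0"
    using rep_nonzero[of i] by auto
  then have "v $ j = inverse c *\<^sub>R v $ i"
    by (simp add: c)
  then have "v $ j \<in> span {v $ i}"
    by (auto simp: span_singleton)
  then have "span {v $ i} = span {v $ j}"
    using * by (simp add: span_eq)
  then have "\<gamma> i = \<gamma> j"
    using rep by (simp add: affine_rep_def span_vec_eq)
  then show False
    using bij assms by (auto simp: bij_betw_def inj_eq)
qed

text \<open>The point \<open>a\<close> is its own mate when \<open>a \<noteq> j\<close>, and the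
  counts below include it.\<close>

definition line_mates :: "'m \<Rightarrow> 'm \<Rightarrow> 'm set" where
  "line_mates j a = {i. i \<noteq> j \<and> v $ i \<in> span {v $ j, v $ a}}"

text \<open>With \<open>d\<close> mates, the line would carry \<open>d + 1\<close> common zeros,
  counting the point of \<open>j\<close>. Every form in \<open>fs\<close> would then vanish on the
  whole line, contradicting finiteness of the zero set.\<close>

lemma card_line_mates:
  assumes "a \<noteq> j"
  shows "card (line_mates j a) < d"
proof (rule ccontr)
  assume "\<not> ?thesis"
  then have card: "d \<le> card (line_mates j a)"
    by simp
  have "\<exists>s t. v $ i = s *\<^sub>R v $ j + t *\<^sub>R v $ a" if i: "i \<in> line_mates j a" for i
  proof -
    from i obtain s where "v $ i - s *\<^sub>R v $ j \<in> span {v $ a}"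
      by (auto simp: line_mates_def span_insert)
    then obtain t where "v $ i - s *\<^sub>R v $ j = t *\<^sub>R v $ a"
      by (auto simp: span_singleton)
    then show ?thesis
      by (metis add.commute diff_add_cancel)
  qed
  then obtain s t where st: "\<And>i. i \<in> line_mates j a \<Longrightarrow> v $ i = s i *\<^sub>R v $ j + t i *\<^sub>R v $ a"
    by metis
  have t: "t i \<noteq> 0" if "i \<in> line_mates j a" for i
    using st[OF that] rep_not_in_span[of i j] that by (auto simp: line_mates_def span_singleton)
  \<comment> \<open>The affine coordinate on the line in which \<open>v $ a\<close> sits at
    \<open>0\<close> and \<open>v $ j\<close> at infinity.\<close>
  define r where "r i = s i / t i" for i
  have r: "v $ i = t i *\<^sub>R (v $ a + r i *\<^sub>R v $ j)" if "i \<in> line_mates j a" for i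
    using st[OF that] t[OF that] by (simp add: r_def scaleR_add_right)
  have "inj_on r (line_mates j a)"
  proof (rule inj_onI, rule ccontr)
    fix i k assume ik: "i \<in> line_mates j a" "k \<in> line_mates j a" "r i = r k" "i \<noteq> k"
    have "v $ i = (t i / t k) *\<^sub>R v $ k"
      using t[OF ik(2)] by (subst r[OF ik(1)], subst r[OF ik(2)]) (simp add: ik)
    then show False
      using rep_not_in_span[OF ik(4)] by (auto simp: span_singleton)
  qed
  then have card_r: "d \<le> card (r ` line_mates j a)"
    using card by (simp add: card_image)
  have vanish: "poly_eval f (v $ a + \<rho> *\<^sub>R v $ j) = 0"
    if f: "f \<in> set fs" and "\<rho> \<in> r ` line_mates j a" for f \<rho>
  proof -
    obtain i where i: "i \<in> line_mates j a" "\<rho> = r i"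
      using \<open>\<rho> \<in> _\<close> by blast
    have "0 = poly_eval f (t i *\<^sub>R (v $ a + \<rho> *\<^sub>R v $ j))"
      using zero[OF f, of i] r[OF i(1)] i(2) by simp
    also have "\<dots> = t i ^ d * poly_eval f (v $ a + \<rho> *\<^sub>R v $ j)"
      using f fs by (intro poly_eval_scale) auto
    finally show ?thesis
      using t[OF i(1)] by simp
  qed
  have line: "poly_eval f (v $ a + \<rho> *\<^sub>R v $ j) = 0" if "f \<in> set fs" for f \<rho>
  proof (rule vanishes_on_line)
    show "f \<in> forms d" "poly_eval f (v $ j) = 0"
      using that fs zero by auto
    show "finite (r ` line_mates j a)"
      by simp
    show "d \<le> card (r ` line_mates j a)"
      by (rule card_r)
  qed (rule vanish[OF that])
  \<comment> \<open>Distinct parameters give distinct projective points, so a line of zeros contains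
    infinitely many of them.\<close>
  have inj: "inj (\<lambda>\<rho>. span {v $ a + \<rho> *\<^sub>R v $ j})"
  proof (rule injI)
    fix \<rho> \<sigma> assume "span {v $ a + \<rho> *\<^sub>R v $ j} = span {v $ a + \<sigma> *\<^sub>R v $ j}"
    then have "v $ a + \<rho> *\<^sub>R v $ j \<in> span {v $ a + \<sigma> *\<^sub>R v $ j}"
      by (metis insertI1 span_base)
    then obtain c where "v $ a + \<rho> *\<^sub>R v $ j = c *\<^sub>R (v $ a + \<sigma> *\<^sub>R v $ j)"
      by (auto simp: span_singleton)
    then have c: "(1 - c) *\<^sub>R v $ a = (c * \<sigma> - \<rho>) *\<^sub>R v $ j"
      by (simp add: algebra_simps)
    have "c = 1"
    proof (rule ccontr)
      assume "c \<noteq> 1"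
      then have "v $ a = inverse (1 - c) *\<^sub>R ((1 - c) *\<^sub>R v $ a)"
        by simp
      also have "\<dots> = (inverse (1 - c) * (c * \<sigma> - \<rho>)) *\<^sub>R v $ j"
        by (simp add: c)
      finally show False
        using rep_not_in_span[OF assms] by (auto simp: span_singleton)
    qed
    then show "\<rho> = \<sigma>"
      using c rep_nonzero by simp
  qed
  have "span {v $ a + \<rho> *\<^sub>R v $ j} \<in> common_zeros fs" for \<rho>
  proof -
    have "v $ a + \<rho> *\<^sub>R v $ j \<noteq> 0"
    proof
      assume "v $ a + \<rho> *\<^sub>R v $ j = 0"
      then have "v $ a = (- \<rho>) *\<^sub>R v $ j"
        by (simp add: eq_neg_iff_add_eq_0)
      then show False
        using rep_not_in_span[OF assms] unfolding span_singleton by blast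
    qed
    then show ?thesis
      using line by (auto simp: common_zeros_def affine_rep_def span_vec_eq)
  qed
  then have "range (\<lambda>\<rho>. span {v $ a + \<rho> *\<^sub>R v $ j}) \<subseteq> common_zeros fs"
    by blast
  moreover have "finite (common_zeros fs :: (real ^ 'n) set set)"
    using bij_betw_finite[OF bij] by simp
  ultimately have "finite (range (\<lambda>\<rho>. span {v $ a + \<rho> *\<^sub>R v $ j}))"
    by (rule finite_subset)
  then have "finite (UNIV :: real set)"
    using inj by (rule finite_imageD)
  then show False
    using infinite_UNIV_char_0 by blast
qed

text \<open>Steinitz exchange: as \<open>v $ j\<close> is not a multiple of \<open>v $ a\<close>,
  lying in the span of the pair would put \<open>v $ b\<close> on the line through
  \<open>v $ j\<close> and \<open>v $ a\<close>.\<close>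

lemma not_in_span_pair:
  assumes "a \<noteq> j" "b \<noteq> j" "b \<notin> line_mates j a"
  shows "v $ j \<notin> span {v $ a, v $ b}"
proof
  assume "v $ j \<in> span {v $ a, v $ b}"
  then have "v $ j \<in> span (insert (v $ b) {v $ a})"
    by (simp add: insert_commute)
  then have "v $ b \<in> span {v $ j, v $ a}"
    using rep_not_in_span[of j a] assms(1) by (metis in_span_insert)
  then show False
    using assms by (simp add: line_mates_def)
qed

section \<open>Interpolation of positive values\<close>

lemma pos_orthant_subset:
  assumes "\<And>j. \<exists>Bs. length Bs = 2 * d \<and> - {j} \<subseteq> \<Union>(set Bs) \<and> (\<forall>B\<in>set Bs. v $ j \<notin> span (($) v ` B))"
  shows "pos_orthant \<subseteq> eval_map v ` nonneg_forms (2 * d)"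
proof
  fix y :: "real ^ 'm" assume y: "y \<in> pos_orthant"
  have "\<exists>q\<in>forms (2 * d). poly_eval q (v $ j) \<noteq> 0 \<and> (\<forall>i. i \<noteq> j \<longrightarrow> poly_eval q (v $ i) = 0)" for j
  proof -
    obtain Bs where "length Bs = 2 * d" "- {j} \<subseteq> \<Union>(set Bs)" "\<forall>B\<in>set Bs. v $ j \<notin> span (($) v ` B)"
      using assms[of j] by blast
    then obtain q where "q \<in> forms (length Bs)" "poly_eval q (v $ j) \<noteq> 0"
      "\<And>i. i \<noteq> j \<Longrightarrow> poly_eval q (v $ i) = 0"
      using separating_form_exists[of Bs "($) v" j] by blast
    then show ?thesis
      using \<open>length Bs = 2 * d\<close> by auto
  qed
  then obtain q where q: "\<And>j. q j \<in> forms (2 * d)" "\<And>j. poly_eval (q j) (v $ j) \<noteq> 0"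
    "\<And>i j. i \<noteq> j \<Longrightarrow> poly_eval (q j) (v $ i) = 0"
    by metis
  \<comment> \<open>Lagrange interpolation, with the separating forms \<open>q j\<close> as
    basis.\<close>
  define p where "p = (\<Sum>j\<in>UNIV. Poly_Mapping.single 0 (y $ j / poly_eval (q j) (v $ j)) * q j)"
  have p: "p \<in> forms (2 * d)"
    unfolding p_def using forms_mult[OF forms_const q(1)] by (intro forms_sum) simp
  have pv: "poly_eval p (v $ i) = y $ i" for i
  proof -
    have "poly_eval p (v $ i)
        = (\<Sum>j\<in>UNIV. y $ j / poly_eval (q j) (v $ j) * poly_eval (q j) (v $ i))"
      by (simp add: p_def poly_eval_sum poly_eval_mult poly_eval_single)
    also have "\<dots> = (\<Sum>j\<in>UNIV. if j = i then y $ i else 0)"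
      using q by (intro sum.cong) auto
    finally show ?thesis
      by simp
  qed
  have "0 < poly_eval p x" if x: "x \<noteq> 0" "\<forall>f\<in>set fs. poly_eval f x = 0" for x :: "real ^ 'n"
  proof -
    obtain j c where "x = c *\<^sub>R v $ j" "c \<noteq> 0"
      by (rule zero_is_multiple[OF x])
    \<comment> \<open>The even degree makes the factor \<open>c ^ (2 * d)\<close> positive whatever
      the sign of \<open>c\<close>.\<close>
    then show ?thesis
      using y by (simp add: poly_eval_scale[OF p] pv pos_orthant_def zero_less_power_eq)
  qed
  from nonneg_form_exists[OF p fs this] obtain g where g: "g \<in> nonneg_forms (2 * d)"
    "\<And>x :: real ^ 'n. \<forall>f\<in>set fs. poly_eval f x = 0 \<Longrightarrow> poly_eval g x = poly_eval p x"
    by blast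
  have "eval_map v g = y"
    by (simp add: vec_eq_iff eval_map_def g(2) zero pv)
  then show "y \<in> eval_map v ` nonneg_forms (2 * d)"
    using g(1) by blast
qed

end

section \<open>Grouping the points for cubics and quadrics\<close>

theorem corollary3p2:
  shows
    "(\<forall>(f1 :: 3 rpoly) f2 (\<Gamma> :: (real ^ 3) set set) (\<gamma> :: 9 \<Rightarrow> (real ^ 3) set) (v :: real ^ 3 ^ 9).
        intersect_transversely 3 [f1, f2] \<and> completely_real [f1, f2] \<and>
        \<Gamma> = common_zeros [f1, f2] \<and> bij_betw \<gamma> UNIV \<Gamma> \<and> (\<forall>j. affine_rep (v $ j) (\<gamma> j)) \<longrightarrow>
        pos_orthant \<subseteq> eval_map v ` nonneg_forms 6) \<and>
     (\<forall>(f1 :: 4 rpoly) f2 f3 (\<Gamma> :: (real ^ 4) set set) (\<gamma> :: 8 \<Rightarrow> (real ^ 4) set) (v :: real ^ 4 ^ 8).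
        intersect_transversely 2 [f1, f2, f3] \<and> completely_real [f1, f2, f3] \<and>
        \<Gamma> = common_zeros [f1, f2, f3] \<and> bij_betw \<gamma> UNIV \<Gamma> \<and> (\<forall>j. affine_rep (v $ j) (\<gamma> j)) \<longrightarrow>
        pos_orthant \<subseteq> eval_map v ` nonneg_forms 4)"
proof (intro conjI allI impI)
  fix f1 f2 :: "3 rpoly" and \<Gamma> :: "(real ^ 3) set set" and \<gamma> :: "9 \<Rightarrow> (real ^ 3) set" and v :: "real ^ 3 ^ 9"
  assume hyp: "intersect_transversely 3 [f1, f2] \<and> completely_real [f1, f2] \<and>
    \<Gamma> = common_zeros [f1, f2] \<and> bij_betw \<gamma> UNIV \<Gamma> \<and> (\<forall>j. affine_rep (v $ j) (\<gamma> j))"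
  interpret finite_zero_set "[f1, f2]" 3 \<gamma> v
    by unfold_locales (use hyp in \<open>auto simp: intersect_transversely_def\<close>)
  \<comment> \<open>The eight other points split into two pairs, neither collinear with point
    \<open>j\<close>, and four singletons: six blocks for degree six.\<close>
  have "\<exists>Bs. length Bs = 2 * 3 \<and> - {j} \<subseteq> \<Union>(set Bs) \<and> (\<forall>B\<in>set Bs. v $ j \<notin> span (($) v ` B))" for j
  proof -
    \<comment> \<open>At most two indices, \<open>a\<close> among them, are mates of
      \<open>a\<close>, so any three indices include a non-mate.\<close>
    have pick: "\<exists>b. b \<in> A - line_mates j a" if "3 \<le> card A" "a \<noteq> j" for A a
    proof -
      have "card (line_mates j a) < card A"
        using card_line_mates[OF that(2)] that(1) by simp
      then have "\<not> A \<subseteq> line_mates j a"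
        by (metis card_mono finite linorder_not_le)
      then show ?thesis by blast
    qed
    have mate: "a \<in> line_mates j a" if "a \<noteq> j" for a
      using that by (simp add: line_mates_def span_base)
    have card: "card (- {j}) = 8"
      by (simp add: Compl_eq_Diff_UNIV)
    then obtain a where a: "a \<noteq> j"
      by (metis ComplD card.empty ex_in_conv singletonI zero_neq_numeral)
    obtain b where b: "b \<noteq> j" "b \<notin> line_mates j a"
      using pick[of "- {j}" a] a card by auto
    then have "b \<noteq> a"
      using mate[OF a] by blast
    \<comment> \<open>The six remaining indices are enough to choose a second pair in the same
      way.\<close>
    define A where "A = - {j} - {a, b}"
    have A: "card A = 6"
      unfolding A_def using a b \<open>b \<noteq> a\<close> card by (subst card_Diff_subset) auto
    then obtain c where c: "c \<in> A"
      by (metis card.empty ex_in_conv zero_neq_numeral)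
    then have "c \<noteq> j"
      by (auto simp: A_def)
    then obtain e where e: "e \<in> A" "e \<notin> line_mates j c"
      using pick[of A c] A by auto
    then have "e \<noteq> j" "e \<noteq> c"
      using mate[OF \<open>c \<noteq> j\<close>] by (auto simp: A_def)
    have "card (A - {c, e}) = 4"
      using A c e \<open>e \<noteq> c\<close> by (subst card_Diff_subset) auto
    then obtain xs where xs: "set xs = A - {c, e}" "length xs = 4"
      by (metis distinct_card finite finite_distinct_list)
    let ?Bs = "[{a, b}, {c, e}] @ map (\<lambda>x. {x}) xs"
    have "length ?Bs = 2 * 3"
      using xs by simp
    moreover have "- {j} \<subseteq> \<Union>(set ?Bs)"
      using xs by (auto simp: A_def)
    moreover have "v $ j \<notin> span (($) v ` B)" if B: "B \<in> set ?Bs" for B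
    proof -
      consider "B = {a, b}" | "B = {c, e}" | x where "B = {x}" "x \<noteq> j"
        using B xs by (auto simp: A_def)
      then show ?thesis
      proof cases
        case 3
        then show ?thesis using rep_not_in_span[of j x] by auto
      qed (use not_in_span_pair a b e \<open>c \<noteq> j\<close> \<open>e \<noteq> j\<close> in auto)
    qed
    ultimately show ?thesis
      by (intro exI[of _ ?Bs]) simp
  qed
  from pos_orthant_subset[OF this] show "pos_orthant \<subseteq> eval_map v ` nonneg_forms 6"
    by simp
next
  fix f1 f2 f3 :: "4 rpoly" and \<Gamma> :: "(real ^ 4) set set" and \<gamma> :: "8 \<Rightarrow> (real ^ 4) set" and v :: "real ^ 4 ^ 8"
  assume hyp: "intersect_transversely 2 [f1, f2, f3] \<and> completely_real [f1, f2, f3] \<and>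
    \<Gamma> = common_zeros [f1, f2, f3] \<and> bij_betw \<gamma> UNIV \<Gamma> \<and> (\<forall>j. affine_rep (v $ j) (\<gamma> j))"
  interpret finite_zero_set "[f1, f2, f3]" 2 \<gamma> v
    by unfold_locales (use hyp in \<open>auto simp: intersect_transversely_def\<close>)
  \<comment> \<open>The seven other points split into three pairs and a singleton: four blocks for
    degree four.\<close>
  have "\<exists>Bs. length Bs = 2 * 2 \<and> - {j} \<subseteq> \<Union>(set Bs) \<and> (\<forall>B\<in>set Bs. v $ j \<notin> span (($) v ` B))" for j
  proof -
    \<comment> \<open>For \<open>d = 2\<close> the only mate of \<open>a\<close> is \<open>a\<close>
      itself, so every pair is admissible. Allowing \<open>a = b\<close> handles the singleton and
      saves recording that the entries of the list \<open>xs\<close> are distinct.\<close>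
    have pair: "v $ j \<notin> span {v $ a, v $ b}" if "a \<noteq> j" "b \<noteq> j" for a b
    proof (cases "a = b")
      case True
      then show ?thesis using rep_not_in_span[of j a] that by simp
    next
      case False
      have "b \<notin> line_mates j a"
      proof
        assume "b \<in> line_mates j a"
        then have "{a, b} \<subseteq> line_mates j a"
          using that by (simp add: line_mates_def span_base)
        then have "card {a, b} \<le> card (line_mates j a)"
          by (intro card_mono) auto
        then show False
          using card_line_mates[OF that(1)] False by simp
      qed
      then show ?thesis
        using that by (intro not_in_span_pair)
    qed
    have "card (- {j}) = 7"
      by (simp add: Compl_eq_Diff_UNIV)
    then obtain xs where xs: "set xs = - {j}" "length xs = 7"
      by (metis distinct_card finite finite_distinct_list)
    then obtain a b c d e f g where "xs = [a, b, c, d, e, f, g]"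
      by (auto simp: length_Suc_conv eval_nat_numeral)
    with xs(1) have abc: "{a, b, c, d, e, f, g} = - {j}"
      by simp
    let ?Bs = "[{a, b}, {c, d}, {e, f}, {g}]"
    have ne: "a \<noteq> j" "b \<noteq> j" "c \<noteq> j" "d \<noteq> j" "e \<noteq> j" "f \<noteq> j" "g \<noteq> j"
      using abc by auto
    have "- {j} \<subseteq> \<Union>(set ?Bs)"
      using abc by auto
    moreover have "\<forall>B\<in>set ?Bs. v $ j \<notin> span (($) v ` B)"
      using pair ne pair[of g g] by simp
    ultimately show ?thesis
      by (intro exI[of _ ?Bs]) simp
  qed
  from pos_orthant_subset[OF this] show "pos_orthant \<subseteq> eval_map v ` nonneg_forms 4"
    by simp
qed

end
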